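(* Let $n$ be a positive integer, let $\mathcal{P} \subseteq \mathbb{R}^n$ be a rational polyhedron, and let $f \colon \mathbb{R}^n \to \mathbb{R}$ be a quadratic function (with real coefficients). Then $f$ is unbounded below on $\mathcal{P} \cap \mathbb{Z}^n$ if and only if there exists a ray $\mathcal{R}(y,d)$ of $\mathcal{P}$ such that, for every constant $\epsilon > 0$, $f$ is unbounded below on $\mathcal{P} \cap \mathbb{Z}^n \cap \left(\mathcal{R}(y,d) + \mathcal{B}_\epsilon\right)$.
   Context: A polyhedron is a set $\mathcal{P} = \{x \in \mathbb{R}^n : Ax \le b\}$ with $A \in \mathbb{R}^{m \times n}$, $b \in \mathbb{R}^m$; it is rational if $A \in \mathbb{Q}^{m\times n}$ and $b \in \mathbb{Q}^m$. A ray in $\mathbb{R}^n$ is a set $\mathcal{R}(y,d) = \{y + \lambda d : \lambda \ge 0\}$ with $y \in \mathbb{R}^n$ and nonzero $d \in \mathbb{R}^n$ (neither $y$ nor $d$ is required to be rational or integral). A ray of $\mathcal{P}$ is a ray fully contained in $\mathcal{P}$. $\mathcal{B}_\epsilon = \{x \in \mathbb{R}^n : \|x\| \le \epsilon\}$ (Euclidean norm), and $+$ between sets denotes the Minkowski sum. A quadratic function is a polynomial function of degree two in the $n$ variables. A function $f$ is unbounded below on a set $S$ if for every $c \in \mathbb{R}$ there is $x \in S$ with $f(x) < c$, and bounded below on $S$ otherwise. *)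

theory Defs
  imports "HOL-Analysis.Analysis" "HOL-Library.Set_Algebras"
begin

definition rational_polyhedron :: "(real ^ 'n) set \<Rightarrow> bool" where
  "rational_polyhedron P \<longleftrightarrow>
     (\<exists>(m::nat) (A :: nat \<Rightarrow> real ^ 'n) (b :: nat \<Rightarrow> real).
        (\<forall>i<m. (\<forall>j. A i $ j \<in> \<rat>) \<and> b i \<in> \<rat>) \<and>
        P = {x. \<forall>i<m. (\<Sum>j\<in>UNIV. A i $ j * x $ j) \<le> b i})"

text \<open>The map \<open>\<alpha>\<close> is the exponent vector of a monomial, \<open>sum \<alpha> UNIV\<close> its total degree.
  There are only finitely many exponent vectors of total degree at most \<open>k\<close>
  (lemma \<open>finite_exponents\<close>), so the sum is a genuine one, and some coefficient of
  total degree exactly \<open>k\<close> is nonzero.\<close>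

definition polynomial_function_of_degree :: "nat \<Rightarrow> (real ^ 'n \<Rightarrow> real) \<Rightarrow> bool" where
  "polynomial_function_of_degree k f \<longleftrightarrow>
     (\<exists>c :: ('n \<Rightarrow> nat) \<Rightarrow> real.
        (\<exists>\<alpha>. sum \<alpha> UNIV = k \<and> c \<alpha> \<noteq> 0) \<and>
        (\<forall>x. f x = (\<Sum>\<alpha> | sum \<alpha> UNIV \<le> k. c \<alpha> * (\<Prod>i\<in>UNIV. x $ i ^ \<alpha> i))))"

lemma finite_exponents: "finite {\<alpha> :: 'n::finite \<Rightarrow> nat. sum \<alpha> UNIV \<le> k}"
proof (rule finite_subset)
  have "\<alpha> i \<le> sum \<alpha> UNIV" for \<alpha> :: "'n \<Rightarrow> nat" and i
    by (rule member_le_sum) auto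
  then show "{\<alpha> :: 'n \<Rightarrow> nat. sum \<alpha> UNIV \<le> k} \<subseteq> PiE UNIV (\<lambda>_. {..k})"
    by (auto intro: order_trans)
  show "finite (PiE (UNIV :: 'n set) (\<lambda>_. {..k}))"
    by (rule finite_PiE) auto
qed

definition quadratic_function :: "(real ^ 'n \<Rightarrow> real) \<Rightarrow> bool" where
  "quadratic_function f \<longleftrightarrow> polynomial_function_of_degree 2 f"

definition integer_lattice :: "(real ^ 'n) set" where
  "integer_lattice = {x. \<forall>i. x $ i \<in> \<int>}"

text \<open>This is a ray only for \<open>d \<noteq> 0\<close>, which has to be required separately.\<close>

definition ray :: "real ^ 'n \<Rightarrow> real ^ 'n \<Rightarrow> (real ^ 'n) set" where
  "ray y d = {y + t *\<^sub>R d | t. t \<ge> 0}"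

definition unbounded_below_on :: "('a \<Rightarrow> real) \<Rightarrow> 'a set \<Rightarrow> bool" where
  "unbounded_below_on f S \<longleftrightarrow> (\<forall>c. \<exists>x\<in>S. f x < c)"

end

theory Submission
  imports Defs
begin

text \<open>The substance is that unboundedness below on the lattice points of \<open>P\<close> produces a ray; a ray
  as described trivially makes \<open>f\<close> unbounded below.

  Take lattice points \<open>x m \<in> P\<close> with \<open>f (x m) < - m\<close>. Scaling each inequality of \<open>P\<close> makes its
  normal vector integral, so that its values on the \<open>x m\<close> are integers bounded above. After passing
  to a subsequence and dropping initial members, all these values are nonincreasing and all
  coordinates are monotone. Hence the difference of every member from the first one, \<open>v\<close>, lies in a pointed cone \<open>K\<close> of recession
  directions of \<open>P\<close>, cut out by integral vectors (\<open>descending_in_pointed_cone\<close>). On \<open>v + K\<close> write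
  \<open>f (v + z) = z \<bullet> q z + g \<bullet> z + f v\<close> with \<open>q\<close> self-adjoint. This is unbounded below on \<open>K\<close>.

  A Frank--Wolfe type argument (\<open>copositive_bounded_below_on_face\<close>) then gives an escape direction:
  some \<open>d \<in> K\<close> with \<open>d \<bullet> q d < 0\<close>, or with \<open>d \<bullet> q d = 0\<close> and \<open>g \<bullet> d < 0\<close>. Indeed, if there is none
  and \<open>d \<noteq> 0\<close> is isotropic, then moving backwards along \<open>d\<close> never increases the function, and
  since \<open>K\<close> is pointed, this leads to a proper face of \<open>K\<close>, where induction applies. Without isotropic
  directions the quadratic part dominates.

  The ray from \<open>v\<close> in direction \<open>d\<close> is the required one, even though \<open>d\<close> may be irrational.
  Simultaneous Dirichlet approximation gives lattice points \<open>z\<close> arbitrarily near \<open>t *\<^sub>R d\<close> with \<open>t\<close>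
  arbitrarily large. They lie in \<open>K\<close> because \<open>a \<bullet> z\<close> is an integer that is less than \<open>1\<close>, for each of the
  integral vectors \<open>a\<close> defining \<open>K\<close> (\<open>integer_lattice_near_multiple_in_cone\<close>). As \<open>v\<close> is a lattice
  point, \<open>v + z\<close> is a lattice point of \<open>P\<close> near the ray, and \<open>f\<close> escapes along these points
  (\<open>unbounded_below_near_escaping_ray\<close>).\<close>

section \<open>Quadratic functions in terms of a self-adjoint map\<close>

definition quadratic_via :: "('a::real_inner \<Rightarrow> 'a) \<Rightarrow> 'a \<Rightarrow> real \<Rightarrow> 'a \<Rightarrow> real" where
  "quadratic_via q c k x = x \<bullet> q x + c \<bullet> x + k"

text \<open>Requiring \<open>q\<close> to be self-adjoint merges the two mixed terms of \<open>(x + y) \<bullet> q (x + y)\<close> into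
  \<open>2 * (x \<bullet> q y)\<close>. The map \<open>q\<close> may vanish, so that the class is closed under sums.\<close>

definition at_most_quadratic :: "('a::real_inner \<Rightarrow> real) \<Rightarrow> bool" where
  "at_most_quadratic f \<longleftrightarrow>
     (\<exists>q c k. linear q \<and> (\<forall>x y. x \<bullet> q y = q x \<bullet> y) \<and> f = quadratic_via q c k)"

lemma at_most_quadraticI:
  assumes "linear q" "\<And>x y. x \<bullet> q y = q x \<bullet> y" "\<And>x. f x = x \<bullet> q x + c \<bullet> x + k"
  shows "at_most_quadratic f"
  unfolding at_most_quadratic_def quadratic_via_def using assms by blast

lemma at_most_quadratic_const: "at_most_quadratic (\<lambda>_. k)"
  by (rule at_most_quadraticI[where q = "\<lambda>_. 0" and c = 0 and k = k])
     (auto intro: linear_zero)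

lemma at_most_quadratic_scale:
  assumes "at_most_quadratic f"
  shows "at_most_quadratic (\<lambda>x. r * f x)"
proof -
  obtain q c k where q: "linear q" "\<And>x y. x \<bullet> q y = q x \<bullet> y"
    and f: "f = quadratic_via q c k"
    using assms unfolding at_most_quadratic_def by blast
  show ?thesis
    by (rule at_most_quadraticI[where q = "\<lambda>x. r *\<^sub>R q x" and c = "r *\<^sub>R c" and k = "r * k"])
       (auto simp: f quadratic_via_def q(2) algebra_simps intro: linear_compose_scale_right q(1))
qed

lemma at_most_quadratic_add:
  assumes "at_most_quadratic f" "at_most_quadratic g"
  shows "at_most_quadratic (\<lambda>x. f x + g x)"
proof -
  obtain q c k where q: "linear q" "\<And>x y. x \<bullet> q y = q x \<bullet> y"
    and f: "f = quadratic_via q c k"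
    using assms(1) unfolding at_most_quadratic_def by blast
  obtain q' c' k' where q': "linear q'" "\<And>x y. x \<bullet> q' y = q' x \<bullet> y"
    and g: "g = quadratic_via q' c' k'"
    using assms(2) unfolding at_most_quadratic_def by blast
  show ?thesis
    by (rule at_most_quadraticI[where q = "\<lambda>x. q x + q' x" and c = "c + c'" and k = "k + k'"])
       (auto simp: f g quadratic_via_def q(2) q'(2) algebra_simps
          intro: linear_compose_add q(1) q'(1))
qed

lemma at_most_quadratic_sum:
  assumes "finite S" "\<And>s. s \<in> S \<Longrightarrow> at_most_quadratic (f s)"
  shows "at_most_quadratic (\<lambda>x. \<Sum>s\<in>S. f s x)"
  using assms
  by (induction S rule: finite_induct) (auto intro: at_most_quadratic_const at_most_quadratic_add)

lemma at_most_quadratic_inner: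
  "at_most_quadratic (\<lambda>x. a \<bullet> x)"
  by (rule at_most_quadraticI[where q = "\<lambda>_. 0" and c = a and k = 0]) (auto intro: linear_zero)

lemma at_most_quadratic_inner_mult:
  "at_most_quadratic (\<lambda>x. (a \<bullet> x) * (b \<bullet> x))"
proof (rule at_most_quadraticI)
  let ?q = "\<lambda>x. (1/2) *\<^sub>R ((a \<bullet> x) *\<^sub>R b + (b \<bullet> x) *\<^sub>R a)"
  show "linear ?q"
    by (rule linearI) (auto simp: algebra_simps)
  show "x \<bullet> ?q y = ?q x \<bullet> y" for x y
    by (simp add: algebra_simps inner_commute)
  show "(a \<bullet> x) * (b \<bullet> x) = x \<bullet> ?q x + 0 \<bullet> x + 0" for x
    by (simp add: algebra_simps inner_commute)
qed

text \<open>Splitting off one variable lowers the total degree by one, so two applications reduce a monomial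
  of degree at most two to a product of coordinates.\<close>

lemma monomial_split:
  fixes \<alpha> :: "'n::finite \<Rightarrow> nat"
  assumes "\<alpha> \<noteq> (\<lambda>_. 0)"
  obtains i \<beta> where "sum \<alpha> UNIV = Suc (sum \<beta> UNIV)"
    "\<And>x :: real ^ 'n. (\<Prod>j\<in>UNIV. x $ j ^ \<alpha> j) = x $ i * (\<Prod>j\<in>UNIV. x $ j ^ \<beta> j)"
proof -
  obtain i where i: "\<alpha> i > 0" using assms by (auto simp: fun_eq_iff)
  define \<beta> where "\<beta> = \<alpha>(i := \<alpha> i - 1)"
  have "Suc (\<beta> i) = \<alpha> i" using i by (simp add: \<beta>_def)
  have "sum \<alpha> UNIV = \<alpha> i + sum \<alpha> (UNIV - {i})" "sum \<beta> UNIV = \<beta> i + sum \<beta> (UNIV - {i})"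
    by (rule sum.remove; simp)+
  moreover have "sum \<alpha> (UNIV - {i}) = sum \<beta> (UNIV - {i})"
    by (rule sum.cong) (auto simp: \<beta>_def)
  ultimately have 1: "sum \<alpha> UNIV = Suc (sum \<beta> UNIV)"
    using \<open>Suc (\<beta> i) = \<alpha> i\<close> by linarith
  have 2: "(\<Prod>j\<in>UNIV. x $ j ^ \<alpha> j) = x $ i * (\<Prod>j\<in>UNIV. x $ j ^ \<beta> j)" for x :: "real ^ 'n"
  proof -
    have "(\<Prod>j\<in>UNIV. x $ j ^ \<alpha> j) = x $ i ^ \<alpha> i * (\<Prod>j\<in>UNIV - {i}. x $ j ^ \<alpha> j)"
      "(\<Prod>j\<in>UNIV. x $ j ^ \<beta> j) = x $ i ^ \<beta> i * (\<Prod>j\<in>UNIV - {i}. x $ j ^ \<beta> j)"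
      by (rule prod.remove; simp)+
    moreover have "(\<Prod>j\<in>UNIV - {i}. x $ j ^ \<alpha> j) = (\<Prod>j\<in>UNIV - {i}. x $ j ^ \<beta> j)"
      by (rule prod.cong) (auto simp: \<beta>_def)
    moreover have "x $ i ^ \<alpha> i = x $ i * x $ i ^ \<beta> i"
      using i by (cases "\<alpha> i") (auto simp: \<beta>_def)
    ultimately show ?thesis by simp
  qed
  show thesis using that 1 2 by blast
qed

lemma at_most_quadratic_monomial:
  fixes \<alpha> :: "'n::finite \<Rightarrow> nat"
  assumes "sum \<alpha> UNIV \<le> 2"
  shows "at_most_quadratic (\<lambda>x :: real ^ 'n. \<Prod>j\<in>UNIV. x $ j ^ \<alpha> j)"
proof (cases "\<alpha> = (\<lambda>_. 0)")
  case True
  then show ?thesis by (simp add: at_most_quadratic_const)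
next
  case False
  then obtain i \<beta> where \<beta>: "sum \<alpha> UNIV = Suc (sum \<beta> UNIV)"
    "\<And>x :: real ^ 'n. (\<Prod>j\<in>UNIV. x $ j ^ \<alpha> j) = x $ i * (\<Prod>j\<in>UNIV. x $ j ^ \<beta> j)"
    using monomial_split by metis
  show ?thesis
  proof (cases "\<beta> = (\<lambda>_. 0)")
    case True
    then show ?thesis
      using at_most_quadratic_inner[of "axis i 1 :: real ^ 'n"] by (simp add: \<beta>(2) inner_axis' inner_real_def)
  next
    case False
    then obtain l \<gamma> where \<gamma>: "sum \<beta> UNIV = Suc (sum \<gamma> UNIV)"
      "\<And>x :: real ^ 'n. (\<Prod>j\<in>UNIV. x $ j ^ \<beta> j) = x $ l * (\<Prod>j\<in>UNIV. x $ j ^ \<gamma> j)"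
      using monomial_split by metis
    have "\<gamma> = (\<lambda>_. 0)" using assms \<beta>(1) \<gamma>(1) by (simp add: fun_eq_iff)
    then show ?thesis
      using at_most_quadratic_inner_mult[of "axis i 1 :: real ^ 'n" "axis l 1"]
      by (simp add: \<beta>(2) \<gamma>(2) inner_axis' inner_real_def)
  qed
qed

lemma quadratic_function_at_most_quadratic:
  fixes f :: "real ^ 'n \<Rightarrow> real"
  assumes "quadratic_function f"
  shows "at_most_quadratic f"
proof -
  obtain c :: "('n \<Rightarrow> nat) \<Rightarrow> real"
    where f: "\<And>x. f x = (\<Sum>\<alpha> | sum \<alpha> UNIV \<le> 2. c \<alpha> * (\<Prod>i\<in>UNIV. x $ i ^ \<alpha> i))"
    using assms unfolding quadratic_function_def polynomial_function_of_degree_def by blast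
  show ?thesis
    unfolding f[abs_def]
    by (intro at_most_quadratic_sum finite_exponents at_most_quadratic_scale
        at_most_quadratic_monomial) auto
qed

lemma quadratic_via_translate:
  assumes "linear q" "\<And>x y. x \<bullet> q y = q x \<bullet> y"
  shows "quadratic_via q c k (v + z) = quadratic_via q (2 *\<^sub>R q v + c) (quadratic_via q c k v) z"
  using assms(2)[of v z]
  by (simp add: quadratic_via_def linear_add[OF assms(1)] algebra_simps inner_commute)

section \<open>Boundedness on a pointed polyhedral cone\<close>

text \<open>The cone is \<open>K = {x. \<forall>a\<in>A. a \<bullet> x \<le> 0}\<close>. The set \<open>T\<close> of tight constraints selects a face and is
  there for the induction, on the number of constraints outside \<open>T\<close>: if the quadratic form is positive
  on the nonzero vectors of the face, then compactness of the unit sphere makes it dominate the linear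
  part. Otherwise the face contains an isotropic unit vector \<open>d\<close>. Going from \<open>x\<close> backwards along \<open>d\<close>
  does not increase the function, and the first constraint that becomes tight puts the point on a
  smaller face.\<close>

lemma copositive_bounded_below_on_face:
  fixes q :: "'a::euclidean_space \<Rightarrow> 'a"
  assumes lin: "linear q" and sa: "\<And>x y. x \<bullet> q y = q x \<bullet> y" and "finite A"
    and pointed: "\<And>d. d \<noteq> 0 \<Longrightarrow> \<forall>a\<in>A. a \<bullet> d \<le> 0 \<Longrightarrow> \<exists>a\<in>A. a \<bullet> d < 0"
    and copos: "\<And>d. \<forall>a\<in>A. a \<bullet> d \<le> 0 \<Longrightarrow> 0 \<le> d \<bullet> q d"
    and flat: "\<And>d. \<forall>a\<in>A. a \<bullet> d \<le> 0 \<Longrightarrow> d \<bullet> q d = 0 \<Longrightarrow> 0 \<le> c \<bullet> d"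
    and "T \<subseteq> A"
  shows "\<exists>M. \<forall>x. (\<forall>a\<in>A. a \<bullet> x \<le> 0) \<longrightarrow> (\<forall>a\<in>T. a \<bullet> x = 0) \<longrightarrow> M \<le> x \<bullet> q x + c \<bullet> x"
  using \<open>T \<subseteq> A\<close>
proof (induction "card (A - T)" arbitrary: T rule: less_induct)
  case less
  define F where "F = {x. (\<forall>a\<in>A. a \<bullet> x \<le> 0) \<and> (\<forall>a\<in>T. a \<bullet> x = 0)}"
  define U where "U = F \<inter> sphere 0 1"
  have cont_q: "continuous_on S q" for S
    using lin linear_continuous_on linear_conv_bounded_linear by blast
  have "F = (\<Inter>a\<in>A. {x. a \<bullet> x \<le> 0}) \<inter> (\<Inter>a\<in>T. {x. a \<bullet> x = 0})"
    by (auto simp: F_def)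
  then have "closed F"
    by (auto intro!: closed_Inter closed_halfspace_le closed_hyperplane)
  then have "compact U"
    unfolding U_def by (intro closed_Int_compact compact_sphere)
  show ?case
  proof (cases "\<exists>d\<in>U. d \<bullet> q d = 0")
    case True
    then obtain d where d: "d \<in> F" "norm d = 1" "d \<bullet> q d = 0"
      by (auto simp: U_def)
    have dK: "\<forall>a\<in>A. a \<bullet> d \<le> 0" and dT: "\<forall>a\<in>T. a \<bullet> d = 0" using d(1) by (auto simp: F_def)
    have "d \<noteq> 0" using d(2) by auto
    define N where "N = {a\<in>A. a \<bullet> d < 0}"
    have N: "finite N" "N \<noteq> {}" "N \<subseteq> A - T"
      using pointed[OF _ dK] \<open>d \<noteq> 0\<close> dT \<open>finite A\<close> by (auto simp: N_def)
    have "\<forall>a\<in>N. \<exists>M. \<forall>x. (\<forall>b\<in>A. b \<bullet> x \<le> 0) \<longrightarrow> (\<forall>b\<in>insert a T. b \<bullet> x = 0)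
        \<longrightarrow> M \<le> x \<bullet> q x + c \<bullet> x"
    proof
      fix a assume "a \<in> N"
      then have "A - insert a T \<subset> A - T" using N by auto
      then have "card (A - insert a T) < card (A - T)"
        using \<open>finite A\<close> by (intro psubset_card_mono) auto
      then show "\<exists>M. \<forall>x. (\<forall>b\<in>A. b \<bullet> x \<le> 0) \<longrightarrow> (\<forall>b\<in>insert a T. b \<bullet> x = 0)
        \<longrightarrow> M \<le> x \<bullet> q x + c \<bullet> x"
        using less.hyps[of "insert a T"] less.prems \<open>a \<in> N\<close> N by blast
    qed
    then obtain M where M: "\<And>a x. a \<in> N \<Longrightarrow> \<forall>b\<in>A. b \<bullet> x \<le> 0 \<Longrightarrow> \<forall>b\<in>insert a T. b \<bullet> x = 0
        \<Longrightarrow> M a \<le> x \<bullet> q x + c \<bullet> x"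
      by metis
    show ?thesis
    proof (intro exI[of _ "Min (M ` N)"] allI impI)
      fix x assume xK: "\<forall>a\<in>A. a \<bullet> x \<le> 0" and xT: "\<forall>a\<in>T. a \<bullet> x = 0"
      \<comment> \<open>An isotropic direction minimizes the form over the cone, so moving from \<open>d\<close> towards \<open>x\<close> cannot
        decrease it to first order; \<open>s\<close> is small enough for the first-order term to decide the sign.\<close>
      have xd: "0 \<le> x \<bullet> q d"
      proof (rule ccontr)
        assume neg: "\<not> 0 \<le> x \<bullet> q d"
        define s where "s = - (x \<bullet> q d) / (x \<bullet> q x + 1)"
        have xx: "0 \<le> x \<bullet> q x" using copos xK by blast
        then have s: "s > 0" using neg by (simp add: s_def divide_neg_pos)
        have "\<forall>a\<in>A. a \<bullet> (d + s *\<^sub>R x) \<le> 0"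
          using dK xK s by (auto simp: inner_add_right intro!: add_nonpos_nonpos mult_nonneg_nonpos)
        then have "0 \<le> (d + s *\<^sub>R x) \<bullet> q (d + s *\<^sub>R x)" by (rule copos)
        also have "\<dots> = s * (2 * (x \<bullet> q d) + s * (x \<bullet> q x))"
          using d(3) sa[of d x]
          by (simp add: linear_add[OF lin] linear_scale[OF lin] algebra_simps inner_commute)
        finally have "0 \<le> 2 * (x \<bullet> q d) + s * (x \<bullet> q x)" using s
          by (simp add: zero_le_mult_iff)
        moreover have "s * (x \<bullet> q x) \<le> s * (x \<bullet> q x + 1)" using s by simp
        moreover have "s * (x \<bullet> q x + 1) = - (x \<bullet> q d)" using xx by (simp add: s_def)
        ultimately show False using neg by linarith
      qed
      \<comment> \<open>The largest step for which \<open>x - t *\<^sub>R d\<close> stays in the cone: only constraints in \<open>N\<close> change,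
        and the minimizing one becomes tight.\<close>
      define t where "t = Min ((\<lambda>a. (a \<bullet> x) / (a \<bullet> d)) ` N)"
      have "t \<in> (\<lambda>a. (a \<bullet> x) / (a \<bullet> d)) ` N"
        unfolding t_def using N by (intro Min_in) auto
      then obtain a where a: "a \<in> N" "t = (a \<bullet> x) / (a \<bullet> d)" by blast
      have t_le: "t \<le> (b \<bullet> x) / (b \<bullet> d)" if "b \<in> N" for b
        unfolding t_def using N that by (intro Min_le) auto
      have "t \<ge> 0" using a xK by (auto simp: N_def intro!: divide_nonpos_nonpos)
      let ?y = "x - t *\<^sub>R d"
      have "b \<bullet> ?y \<le> 0" if "b \<in> A" for b
      proof (cases "b \<in> N")
        case True
        then have "b \<bullet> d < 0" by (simp add: N_def)
        then show ?thesis using t_le[OF True] by (simp add: inner_diff_right neg_le_divide_eq)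
      next
        case False
        then have "b \<bullet> d = 0" using dK that by (force simp: N_def)
        then show ?thesis using xK that by (simp add: inner_diff_right)
      qed
      moreover have "\<forall>b\<in>insert a T. b \<bullet> ?y = 0"
        using a dT xT by (auto simp: inner_diff_right N_def)
      ultimately have "M a \<le> ?y \<bullet> q ?y + c \<bullet> ?y" using M a(1) by blast
      also have "\<dots> = x \<bullet> q x + c \<bullet> x - t * (2 * (x \<bullet> q d) + c \<bullet> d)"
        using d(3) sa[of d x]
        by (simp add: linear_diff[OF lin] linear_scale[OF lin] algebra_simps inner_commute)
      also have "\<dots> \<le> x \<bullet> q x + c \<bullet> x"
        using \<open>t \<ge> 0\<close> xd flat[OF dK d(3)] by simp
      finally show "Min (M ` N) \<le> x \<bullet> q x + c \<bullet> x"
        using N a(1) by (meson Min_le finite_imageI image_eqI order_trans)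
    qed
  next
    case False
    have "\<exists>\<delta>>0. \<forall>u\<in>U. \<delta> \<le> u \<bullet> q u"
    proof (cases "U = {}")
      case True
      then show ?thesis by (auto intro: zero_less_one)
    next
      case ne: False
      have "continuous_on U (\<lambda>u. u \<bullet> q u)"
        by (intro continuous_intros cont_q)
      then obtain u where u: "u \<in> U" "\<forall>w\<in>U. u \<bullet> q u \<le> w \<bullet> q w"
        using continuous_attains_inf[OF \<open>compact U\<close> ne] by blast
      have "0 \<le> u \<bullet> q u" using u(1) by (intro copos) (auto simp: U_def F_def)
      then have "0 < u \<bullet> q u" using False u(1) by force
      then show ?thesis using u(2) by blast
    qed
    then obtain \<delta> where \<delta>: "\<delta> > 0" "\<And>u. u \<in> U \<Longrightarrow> \<delta> \<le> u \<bullet> q u" by blast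
    show ?thesis
    proof (intro exI[of _ "- (norm c)\<^sup>2 / (4 * \<delta>)"] allI impI)
      fix x assume xK: "\<forall>a\<in>A. a \<bullet> x \<le> 0" and xT: "\<forall>a\<in>T. a \<bullet> x = 0"
      have "\<delta> * (norm x)\<^sup>2 \<le> x \<bullet> q x"
      proof (cases "x = 0")
        case True
        then show ?thesis by simp
      next
        case False
        define u where "u = (1 / norm x) *\<^sub>R x"
        have "u \<in> U" using xK xT False
          by (auto simp: u_def U_def F_def divide_le_0_iff)
        then have "\<delta> * (norm x)\<^sup>2 \<le> (u \<bullet> q u) * (norm x)\<^sup>2"
          by (intro mult_right_mono \<delta>) auto
        also have "\<dots> = x \<bullet> q x" using False
          by (simp add: u_def linear_scale[OF lin] power2_eq_square)
        finally show ?thesis .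
      qed
      moreover have "- (norm c * norm x) \<le> c \<bullet> x"
        using Cauchy_Schwarz_ineq2[of c x] by linarith
      moreover have "- (norm c)\<^sup>2 / (4 * \<delta>) \<le> \<delta> * (norm x)\<^sup>2 - norm c * norm x"
      proof -
        \<comment> \<open>The bound is the minimum of the parabola \<open>\<delta> * s\<^sup>2 - norm c * s\<close>; complete the square.\<close>
        have "0 \<le> (2 * \<delta> * norm x - norm c)\<^sup>2" by simp
        then have "- (norm c)\<^sup>2 \<le> (\<delta> * (norm x)\<^sup>2 - norm c * norm x) * (4 * \<delta>)"
          by (simp add: power2_eq_square algebra_simps)
        then show ?thesis using \<delta>(1) by (subst pos_divide_le_eq) auto
      qed
      ultimately show "- (norm c)\<^sup>2 / (4 * \<delta>) \<le> x \<bullet> q x + c \<bullet> x" by linarith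
    qed
  qed
qed

section \<open>Lattice points near a ray of an integral cone\<close>

lemma integer_lattice_inner:
  assumes "a \<in> integer_lattice" "z \<in> integer_lattice"
  shows "a \<bullet> z \<in> \<int>"
  using assms by (auto simp: integer_lattice_def inner_vec_def)

text \<open>Dirichlet's theorem bounds the multiplier from above only. Applying it to a large integer multiple
  \<open>S\<close> of \<open>d\<close> makes \<open>t\<close>, a positive integer times \<open>S\<close>, as large as desired.\<close>

lemma integer_lattice_near_multiple:
  fixes d :: "real ^ 'n"
  assumes "\<epsilon> > 0"
  obtains t z where "T \<le> t" "z \<in> integer_lattice" "norm (z - t *\<^sub>R d) < \<epsilon>"
proof -
  obtain e :: "nat \<Rightarrow> 'n" where e: "bij_betw e {..<CARD('n)} UNIV"
    using ex_bij_betw_nat_finite[of "UNIV :: 'n set"] by (auto simp: atLeast0LessThan)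
  define S where "S = max 1 (nat \<lceil>T\<rceil>)"
  obtain N :: nat where N: "of_nat N > real CARD('n) / \<epsilon>" using reals_Archimedean2 by blast
  then have "N > 0" using assms by (metis divide_nonneg_pos gr0I of_nat_0 of_nat_0_le_iff not_le)
  then obtain p :: "nat \<Rightarrow> int" and k :: int where k: "0 < k"
    and p: "\<And>i. i < CARD('n) \<Longrightarrow> \<bar>of_int k * (real S * d $ e i) - of_int (p i)\<bar> < 1 / N"
    using Dirichlet_approx_simult[of N "CARD('n)" "\<lambda>i. real S * d $ e i"]
    by blast
  let ?t = "of_int k * real S"
  define z :: "real ^ 'n" where "z = (\<chi> j. of_int (p (inv_into {..<CARD('n)} e j)))"
  have zj: "\<bar>(z - ?t *\<^sub>R d) $ j\<bar> < 1 / N" for j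
  proof -
    let ?i = "inv_into {..<CARD('n)} e j"
    have "?i < CARD('n)" "e ?i = j"
      using e inv_into_into[of j e "{..<CARD('n)}"] f_inv_into_f[of j e "{..<CARD('n)}"]
      by (auto simp: bij_betw_def)
    then show ?thesis using p[of ?i] by (simp add: z_def abs_minus_commute mult.assoc)
  qed
  have "norm (z - ?t *\<^sub>R d) \<le> (\<Sum>j\<in>UNIV. \<bar>(z - ?t *\<^sub>R d) $ j\<bar>)"
    by (rule norm_le_l1_cart)
  also have "\<dots> \<le> (\<Sum>j\<in>(UNIV :: 'n set). 1 / N)"
    by (intro sum_mono less_imp_le zj)
  also have "\<dots> < \<epsilon>" using N \<open>N > 0\<close> assms by (simp add: field_simps)
  finally have "norm (z - ?t *\<^sub>R d) < \<epsilon>" .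
  moreover have "z \<in> integer_lattice" by (simp add: z_def integer_lattice_def)
  moreover have "T \<le> ?t"
  proof -
    have "T \<le> real S" by (simp add: S_def) linarith
    also have "\<dots> \<le> ?t" using k by (simp add: mult_le_cancel_right1)
    finally show ?thesis .
  qed
  ultimately show thesis by (intro that)
qed

text \<open>A lattice point close to a vector of the cone is itself in the cone: for an integral constraint
  vector \<open>a\<close>, the integer \<open>a \<bullet> z\<close> exceeds \<open>t * (a \<bullet> d) \<le> 0\<close> by less than \<open>1\<close>.\<close>

lemma integer_lattice_near_multiple_in_cone:
  fixes d :: "real ^ 'n"
  assumes "\<epsilon> > 0" "finite A" "A \<subseteq> integer_lattice" and d: "\<forall>a\<in>A. a \<bullet> d \<le> 0"
  obtains t z where "T \<le> t" "z \<in> integer_lattice" "norm (z - t *\<^sub>R d) < \<epsilon>" "\<forall>a\<in>A. a \<bullet> z \<le> 0"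
proof -
  define L where "L = 1 + (\<Sum>a\<in>A. norm a)"
  have L: "norm a \<le> L" if "a \<in> A" for a
    unfolding L_def using member_le_sum[of a A norm] that \<open>finite A\<close> by simp
  have "L > 0" unfolding L_def by (simp add: add_pos_nonneg sum_nonneg)
  obtain t z where tz: "max 0 T \<le> t" "z \<in> integer_lattice" "norm (z - t *\<^sub>R d) < min \<epsilon> (1 / L)"
    using integer_lattice_near_multiple[of "min \<epsilon> (1 / L)" "max 0 T" d] \<open>\<epsilon> > 0\<close> \<open>L > 0\<close> by auto
  have "a \<bullet> z \<le> 0" if "a \<in> A" for a
  proof -
    have "a \<bullet> (z - t *\<^sub>R d) \<le> norm a * norm (z - t *\<^sub>R d)" by (rule norm_cauchy_schwarz)
    also have "\<dots> \<le> L * norm (z - t *\<^sub>R d)" by (intro mult_right_mono L that) auto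
    also have "\<dots> < 1" using tz(3) \<open>L > 0\<close> by (simp add: field_simps)
    finally have "a \<bullet> z < 1 + t * (a \<bullet> d)" by (simp add: inner_diff_right)
    also have "\<dots> \<le> 1" using tz(1) d that by (simp add: mult_nonneg_nonpos)
    finally have "a \<bullet> z < 1" .
    moreover have "a \<bullet> z \<in> \<int>"
      using integer_lattice_inner that tz(2) \<open>A \<subseteq> integer_lattice\<close> by blast
    ultimately show ?thesis by (auto elim!: Ints_cases)
  qed
  then show thesis using that[of t z] tz by auto
qed

text \<open>For \<open>z = t *\<^sub>R d + w\<close> the value is \<open>t\<^sup>2 * (d \<bullet> q d) + t * (2 * (w \<bullet> q d) + c \<bullet> d)\<close> plus terms in \<open>w\<close>
  alone. If \<open>d \<bullet> q d < 0\<close>, the first term wins for any bounded \<open>w\<close>. If \<open>d \<bullet> q d = 0\<close>, then \<open>w\<close> has to be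
  so small that the coefficient of \<open>t\<close> keeps the sign of \<open>c \<bullet> d\<close>, which is why points much closer to the
  ray than \<open>\<epsilon>\<close> may be needed.\<close>

lemma unbounded_below_near_escaping_ray:
  fixes q :: "real ^ 'n \<Rightarrow> real ^ 'n"
  assumes lin: "linear q" and sa: "\<And>x y. x \<bullet> q y = q x \<bullet> y"
    and A: "finite A" "A \<subseteq> integer_lattice" "\<forall>a\<in>A. a \<bullet> d \<le> 0"
    and escape: "d \<bullet> q d < 0 \<or> d \<bullet> q d = 0 \<and> c \<bullet> d < 0"
    and "\<epsilon> > 0"
  obtains t z where "0 \<le> t" "z \<in> integer_lattice" "norm (z - t *\<^sub>R d) \<le> \<epsilon>"
    "\<forall>a\<in>A. a \<bullet> z \<le> 0" "z \<bullet> q z + c \<bullet> z < r"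
proof -
  define \<alpha> where "\<alpha> = d \<bullet> q d"
  obtain B where B: "\<And>w. norm (q w) \<le> norm w * B" "B > 0"
    using lin linear_conv_bounded_linear bounded_linear.pos_bounded by metis
  \<comment> \<open>Both kinds of escape reduce to one estimate: within distance \<open>\<eta>\<close> of the ray, the terms that grow
    with \<open>t\<close> are eventually below a linear function of negative slope \<open>s\<close>.\<close>
  have "\<exists>\<eta> s T. 0 < \<eta> \<and> \<eta> \<le> min \<epsilon> 1 \<and> s < 0 \<and> 0 \<le> T \<and>
    (\<forall>t\<ge>T. t * (t * \<alpha> + 2 * \<eta> * norm (q d) + c \<bullet> d) \<le> t * s)"
  proof (cases "\<alpha> < 0")
    case True
    define T where "T = max 0 ((2 * min \<epsilon> 1 * norm (q d) + c \<bullet> d + 1) / (- \<alpha>))"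
    have "t * (t * \<alpha> + 2 * min \<epsilon> 1 * norm (q d) + c \<bullet> d) \<le> t * (-1)" if "T \<le> t" for t
    proof (rule mult_left_mono)
      have "(2 * min \<epsilon> 1 * norm (q d) + c \<bullet> d + 1) / (- \<alpha>) \<le> t" using that by (simp add: T_def)
      then show "t * \<alpha> + 2 * min \<epsilon> 1 * norm (q d) + c \<bullet> d \<le> -1"
        using True by (simp add: pos_divide_le_eq del: divide_minus_right)
      show "0 \<le> t" using that by (simp add: T_def)
    qed
    then show ?thesis using \<open>\<epsilon> > 0\<close>
      by (intro exI[of _ "min \<epsilon> 1"] exI[of _ "-1"] exI[of _ T]) (auto simp: T_def)
  next
    case False
    then have 0: "\<alpha> = 0" "c \<bullet> d < 0" using escape by (auto simp: \<alpha>_def)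
    define \<eta> where "\<eta> = min (min \<epsilon> 1) (- (c \<bullet> d) / (4 * (norm (q d) + 1)))"
    have n: "norm (q d) + 1 > 0" by (simp add: add_nonneg_pos)
    have "\<eta> > 0" using 0 n \<open>\<epsilon> > 0\<close> by (simp add: \<eta>_def divide_neg_pos)
    have "\<eta> \<le> - (c \<bullet> d) / (4 * (norm (q d) + 1))" by (simp add: \<eta>_def)
    then have "\<eta> * (4 * (norm (q d) + 1)) \<le> - (c \<bullet> d)"
      using n by (subst (asm) pos_le_divide_eq) auto
    then have "4 * \<eta> * (norm (q d) + 1) \<le> - (c \<bullet> d)" by (simp only: ac_simps)
    moreover have "4 * \<eta> * norm (q d) \<le> 4 * \<eta> * (norm (q d) + 1)" using \<open>\<eta> > 0\<close> by simp
    ultimately have "2 * \<eta> * norm (q d) + c \<bullet> d \<le> (c \<bullet> d) / 2" by linarith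
    then have "\<forall>t\<ge>0. t * (t * \<alpha> + 2 * \<eta> * norm (q d) + c \<bullet> d) \<le> t * ((c \<bullet> d) / 2)"
      using 0(1) by (intro allI impI mult_left_mono) auto
    then show ?thesis using \<open>\<eta> > 0\<close> 0(2)
      by (intro exI[of _ \<eta>] exI[of _ "(c \<bullet> d) / 2"] exI[of _ 0]) (auto simp: \<eta>_def)
  qed
  then obtain \<eta> s T where \<eta>: "0 < \<eta>" "\<eta> \<le> \<epsilon>" "\<eta> \<le> 1" and s: "s < 0" and "0 \<le> T"
    and T: "\<And>t. t \<ge> T \<Longrightarrow> t * (t * \<alpha> + 2 * \<eta> * norm (q d) + c \<bullet> d) \<le> t * s"
    by auto
  define E where "E = B + norm c"
  define T' where "T' = max T ((E - r + 1) / (- s))"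
  obtain t z where tz: "T' \<le> t" "z \<in> integer_lattice" "norm (z - t *\<^sub>R d) < \<eta>"
      "\<forall>a\<in>A. a \<bullet> z \<le> 0"
    using integer_lattice_near_multiple_in_cone[OF \<eta>(1) A] by metis
  define w where "w = z - t *\<^sub>R d"
  have z: "z = t *\<^sub>R d + w" and w: "norm w \<le> \<eta>" "norm w \<le> 1" using tz(3) \<eta> by (auto simp: w_def)
  have "T \<le> t" using tz(1) by (simp add: T'_def)
  then have "0 \<le> t" using \<open>0 \<le> T\<close> by linarith
  have "(E - r + 1) / (- s) \<le> t" using tz(1) by (simp add: T'_def)
  then have ts: "t * s + E \<le> r - 1" using s by (simp add: pos_divide_le_eq del: divide_minus_right)
  have "w \<bullet> q d \<le> norm w * norm (q d)" by (rule norm_cauchy_schwarz)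
  also have "\<dots> \<le> \<eta> * norm (q d)" using w by (simp add: mult_right_mono)
  finally have wqd: "w \<bullet> q d \<le> \<eta> * norm (q d)" .
  have "w \<bullet> q w \<le> norm w * norm (q w)" by (rule norm_cauchy_schwarz)
  also have "\<dots> \<le> 1 * (1 * B)"
    using w B by (intro mult_mono order_trans[OF B(1)]) auto
  finally have wqw: "w \<bullet> q w \<le> B" by simp
  have "c \<bullet> w \<le> norm c * norm w" by (rule norm_cauchy_schwarz)
  also have "\<dots> \<le> norm c" using w by (simp add: mult_left_le)
  finally have cw: "c \<bullet> w \<le> norm c" .
  have "z \<bullet> q z + c \<bullet> z = t * (t * \<alpha> + 2 * (w \<bullet> q d) + c \<bullet> d) + (w \<bullet> q w + c \<bullet> w)"
    using sa[of d w]
    by (simp add: z \<alpha>_def linear_add[OF lin] linear_scale[OF lin] algebra_simps inner_commute)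
  also have "\<dots> \<le> t * (t * \<alpha> + 2 * \<eta> * norm (q d) + c \<bullet> d) + E"
    using wqd wqw cw \<open>0 \<le> t\<close> unfolding E_def by (intro add_mono mult_left_mono) auto
  also have "\<dots> \<le> t * s + E" using T[OF \<open>T \<le> t\<close>] by simp
  also have "\<dots> < r" using ts by simp
  finally have "z \<bullet> q z + c \<bullet> z < r" .
  then show thesis using that[of t z] tz \<eta> \<open>0 \<le> t\<close> by auto
qed

section \<open>Lattice points descending into a pointed cone\<close>

lemma monoseq_subseq:
  fixes u :: "nat \<Rightarrow> 'a::linorder"
  assumes "monoseq u" "strict_mono r"
  shows "monoseq (\<lambda>k. u (r k))"
  using assms unfolding monoseq_def by (meson strict_mono_less_eq)

lemma common_monoseq_subseq:
  fixes u :: "'i \<Rightarrow> nat \<Rightarrow> 'a::linorder"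
  assumes "finite I"
  shows "\<exists>r. strict_mono r \<and> (\<forall>i\<in>I. monoseq (\<lambda>k. u i (r k)))"
  using assms
proof (induction I rule: finite_induct)
  case empty
  show ?case by (auto intro: strict_mono_id)
next
  case (insert i I)
  then obtain r where r: "strict_mono r" "\<forall>i\<in>I. monoseq (\<lambda>k. u i (r k))" by blast
  obtain s where s: "strict_mono s" "monoseq (\<lambda>k. u i (r (s k)))"
    using seq_monosub[of "\<lambda>k. u i (r k)"] by blast
  have "strict_mono (\<lambda>k. r (s k))" using r(1) s(1) by (simp add: strict_mono_def)
  moreover have "\<forall>i\<in>I. monoseq (\<lambda>k. u i (r (s k)))"
    using r(2) monoseq_subseq[OF _ s(1)] by blast
  ultimately show ?case using s(2) by (intro exI[of _ "\<lambda>k. r (s k)"]) auto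
qed

text \<open>A nondecreasing integer sequence that is bounded above is eventually constant, so in either
  monotone case the tail lies below its first member.\<close>

lemma monoseq_Ints_bdd_above_eventually_max:
  fixes u :: "nat \<Rightarrow> real"
  assumes "monoseq u" "\<And>k. u k \<in> \<int>" "\<And>k. u k \<le> b"
  shows "\<forall>\<^sub>F N in sequentially. \<forall>k\<ge>N. u k \<le> u N"
proof -
  consider "decseq u" | "incseq u" using assms(1) by (auto simp: monoseq_iff)
  then show ?thesis
  proof cases
    case 1
    then show ?thesis by (simp add: decseq_def)
  next
    case 2
    \<comment> \<open>The gap below \<open>b\<close>, rounded down, is a natural number and hence attains its minimum.\<close>
    obtain N where N: "\<And>k. nat \<lfloor>b - u N\<rfloor> \<le> nat \<lfloor>b - u k\<rfloor>"
      using ex_has_least_nat[of "\<lambda>_. True" _ "\<lambda>k. nat \<lfloor>b - u k\<rfloor>"] by blast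
    have "u k \<le> u N" for k
    proof -
      obtain i j where ij: "u N = of_int i" "u k = of_int j" using assms(2) by (meson Ints_cases)
      have "0 \<le> \<lfloor>b - u N\<rfloor>" "0 \<le> \<lfloor>b - u k\<rfloor>" using assms(3)[of N] assms(3)[of k] by auto
      then show ?thesis using N[of k] by (simp add: ij)
    qed
    then show ?thesis
      using 2 unfolding eventually_sequentially incseq_def by (meson order_trans)
  qed
qed

text \<open>The given vectors \<open>R\<close> alone may describe a cone that contains a line. Choosing the subsequence
  monotone in every coordinate as well allows adding a signed unit vector for each coordinate, which
  confines the cone to an orthant and so makes it pointed.\<close>

lemma descending_in_pointed_cone:
  fixes x :: "nat \<Rightarrow> real ^ 'n"
  assumes "finite R" "R \<subseteq> integer_lattice" and x: "\<And>k. x k \<in> integer_lattice"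
    and bdd: "\<forall>a\<in>R. \<exists>b. \<forall>k. a \<bullet> x k \<le> b"
  obtains A and N :: nat and r :: "nat \<Rightarrow> nat" where "finite A" "A \<subseteq> integer_lattice" "R \<subseteq> A"
    "\<And>d. d \<noteq> 0 \<Longrightarrow> \<forall>a\<in>A. a \<bullet> d \<le> 0 \<Longrightarrow> \<exists>a\<in>A. a \<bullet> d < 0"
    "strict_mono r" "\<And>k a. k \<ge> N \<Longrightarrow> a \<in> A \<Longrightarrow> a \<bullet> (x (r k) - x (r N)) \<le> 0"
proof -
  define I where "I = R \<union> range (\<lambda>j. axis j 1)"
  have "finite I" using \<open>finite R\<close> by (simp add: I_def)
  then obtain r where r: "strict_mono r" "\<And>a. a \<in> I \<Longrightarrow> monoseq (\<lambda>k. a \<bullet> x (r k))"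
    using common_monoseq_subseq[of I "\<lambda>a k. a \<bullet> x k"] by blast
  have "\<forall>a\<in>R. \<forall>\<^sub>F N in sequentially. \<forall>k\<ge>N. a \<bullet> x (r k) \<le> a \<bullet> x (r N)"
  proof
    fix a assume a: "a \<in> R"
    obtain b where b: "\<forall>k. a \<bullet> x k \<le> b" using bdd a by blast
    have "a \<bullet> x (r k) \<in> \<int>" for k
      using integer_lattice_inner x a \<open>R \<subseteq> integer_lattice\<close> by blast
    then show "\<forall>\<^sub>F N in sequentially. \<forall>k\<ge>N. a \<bullet> x (r k) \<le> a \<bullet> x (r N)"
      using r(2)[of a] a b by (intro monoseq_Ints_bdd_above_eventually_max) (auto simp: I_def)
  qed
  then have "\<forall>\<^sub>F N in sequentially. \<forall>a\<in>R. \<forall>k\<ge>N. a \<bullet> x (r k) \<le> a \<bullet> x (r N)"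
    by (rule eventually_ball_finite[OF \<open>finite R\<close>])
  then obtain N where N: "\<And>a k. a \<in> R \<Longrightarrow> k \<ge> N \<Longrightarrow> a \<bullet> x (r k) \<le> a \<bullet> x (r N)"
    using eventually_happens'[OF sequentially_bot] by blast
  define \<sigma> :: "'n \<Rightarrow> real" where
    "\<sigma> j = (if decseq (\<lambda>k. x (r k) $ j) then 1 else -1)" for j
  have \<sigma>: "\<sigma> j * (x (r k) $ j - x (r N) $ j) \<le> 0" if "k \<ge> N" for j k
  proof -
    have "monoseq (\<lambda>k. x (r k) $ j)"
      using r(2)[of "axis j 1"] by (simp add: I_def inner_axis' inner_real_def)
    then show ?thesis using that by (auto simp: \<sigma>_def monoseq_iff decseq_def incseq_def)
  qed
  define A where "A = R \<union> range (\<lambda>j. axis j (\<sigma> j))"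
  show thesis
  proof (rule that[of A r N])
    show "finite A" using \<open>finite R\<close> by (simp add: A_def)
    show "A \<subseteq> integer_lattice"
      using \<open>R \<subseteq> integer_lattice\<close> by (auto simp: A_def integer_lattice_def axis_def \<sigma>_def)
    show "R \<subseteq> A" by (simp add: A_def)
    show "strict_mono r" by fact
    show "\<exists>a\<in>A. a \<bullet> d < 0" if "d \<noteq> 0" "\<forall>a\<in>A. a \<bullet> d \<le> 0" for d
    proof -
      obtain j where "d $ j \<noteq> 0" using \<open>d \<noteq> 0\<close> by (auto simp: vec_eq_iff)
      then have "axis j (\<sigma> j) \<bullet> d \<noteq> 0" by (simp add: inner_axis' inner_real_def \<sigma>_def)
      moreover have "axis j (\<sigma> j) \<in> A" by (simp add: A_def)
      ultimately show ?thesis using that(2) by force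
    qed
    show "a \<bullet> (x (r k) - x (r N)) \<le> 0" if "k \<ge> N" "a \<in> A" for k a
      using that N \<sigma> by (auto simp: A_def inner_diff_right inner_axis' inner_real_def right_diff_distrib)
  qed
qed

section \<open>The ray along which a quadratic function escapes\<close>

lemma Rats_common_denominator:
  fixes a :: "real ^ 'n"
  assumes "\<And>j. a $ j \<in> \<rat>"
  obtains D :: nat where "D > 0" "real D *\<^sub>R a \<in> integer_lattice"
proof -
  have "\<exists>D::nat. D > 0 \<and> real D * a $ j \<in> \<int>" for j
  proof -
    obtain m n where "n \<noteq> 0" "\<bar>a $ j\<bar> = real m / real n"
      using Rats_abs_nat_div_natE[OF assms[of j]] by metis
    then have "\<bar>real n * a $ j\<bar> = real m" by (simp add: abs_mult)
    then have "real n * a $ j \<in> \<int>" 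
      by (metis Ints_minus Ints_of_nat abs_if minus_minus)
    then show ?thesis using \<open>n \<noteq> 0\<close> by blast
  qed
  then obtain D where D: "\<And>j. D j > (0::nat)" "\<And>j. real (D j) * a $ j \<in> \<int>" by metis
  have "real (\<Prod>j\<in>UNIV. D j) * a $ i \<in> \<int>" for i
  proof -
    have "real (\<Prod>j\<in>UNIV. D j) * a $ i = real (\<Prod>j\<in>UNIV - {i}. D j) * (real (D i) * a $ i)"
      by (subst prod.remove[of UNIV i]) auto
    then show ?thesis using D(2) by (metis Ints_mult Ints_of_nat)
  qed
  then show thesis using that[of "\<Prod>j\<in>UNIV. D j"] D(1)
    by (simp add: integer_lattice_def prod_pos)
qed

text \<open>Clearing denominators of the constraint vectors makes them take integer values on lattice points.
  The polyhedron enters the argument only through upper bounds of these vectors on \<open>P\<close> and through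
  the recession directions that they describe.\<close>

lemma rational_polyhedron_integral_normals:
  fixes P :: "(real ^ 'n) set"
  assumes "rational_polyhedron P"
  obtains R where "finite R" "R \<subseteq> integer_lattice"
    "\<And>a. a \<in> R \<Longrightarrow> \<exists>b. \<forall>x\<in>P. a \<bullet> x \<le> b"
    "\<And>x z. x \<in> P \<Longrightarrow> \<forall>a\<in>R. a \<bullet> z \<le> 0 \<Longrightarrow> x + z \<in> P"
proof -
  obtain m :: nat and A :: "nat \<Rightarrow> real ^ 'n" and b :: "nat \<Rightarrow> real"
    where rat: "\<And>i j. i < m \<Longrightarrow> A i $ j \<in> \<rat>"
      and "P = {x. \<forall>i<m. (\<Sum>j\<in>UNIV. A i $ j * x $ j) \<le> b i}"
    using assms unfolding rational_polyhedron_def by blast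
  then have P: "P = {x. \<forall>i<m. A i \<bullet> x \<le> b i}" by (simp add: inner_vec_def)
  have "\<forall>i\<in>{..<m}. \<exists>D::nat. D > 0 \<and> real D *\<^sub>R A i \<in> integer_lattice"
    using Rats_common_denominator rat by (metis lessThan_iff)
  then obtain D :: "nat \<Rightarrow> nat"
    where D: "\<And>i. i < m \<Longrightarrow> D i > 0" "\<And>i. i < m \<Longrightarrow> real (D i) *\<^sub>R A i \<in> integer_lattice"
    by (metis lessThan_iff)
  show thesis
  proof (rule that[of "(\<lambda>i. real (D i) *\<^sub>R A i) ` {..<m}"])
    show "\<exists>b. \<forall>x\<in>P. a \<bullet> x \<le> b" if "a \<in> (\<lambda>i. real (D i) *\<^sub>R A i) ` {..<m}" for a
    proof -
      obtain i where "i < m" "a = real (D i) *\<^sub>R A i"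
        using \<open>a \<in> _\<close> by (meson imageE lessThan_iff)
      then have "\<forall>x\<in>P. a \<bullet> x \<le> real (D i) * b i" by (auto simp: P intro: mult_left_mono)
      then show ?thesis by blast
    qed
    show "x + z \<in> P" if "x \<in> P" "\<forall>a\<in>(\<lambda>i. real (D i) *\<^sub>R A i) ` {..<m}. a \<bullet> z \<le> 0" for x z
    proof -
      have "A i \<bullet> z \<le> 0" if "i < m" for i
        using \<open>\<forall>a\<in>_. a \<bullet> z \<le> 0\<close> D(1)[OF that] that by (auto simp: mult_le_0_iff)
      then show ?thesis using \<open>x \<in> P\<close> by (force simp: P inner_add_right)
    qed
  qed (use D(2) in auto)
qed

theorem theorem3:
  fixes P :: "(real ^ 'n) set" and f :: "real ^ 'n \<Rightarrow> real"
  assumes "rational_polyhedron P"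
    and "quadratic_function f"
  shows "unbounded_below_on f (P \<inter> integer_lattice) \<longleftrightarrow>
    (\<exists>y d. d \<noteq> 0 \<and> ray y d \<subseteq> P \<and>
      (\<forall>\<epsilon>>0. unbounded_below_on f (P \<inter> integer_lattice \<inter> (ray y d + cball 0 \<epsilon>))))"
    (is "?unbounded \<longleftrightarrow> ?ray")
proof
  assume ?ray
  then obtain y d where "unbounded_below_on f (P \<inter> integer_lattice \<inter> (ray y d + cball 0 1))"
    by (meson zero_less_one)
  then show ?unbounded unfolding unbounded_below_on_def by blast
next
  assume unb: ?unbounded
  obtain q c k where lin: "linear q" and sa: "\<And>x y. x \<bullet> q y = q x \<bullet> y"
    and f: "f = quadratic_via q c k"
    using quadratic_function_at_most_quadratic[OF assms(2)] unfolding at_most_quadratic_def by blast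
  obtain R where R: "finite R" "R \<subseteq> integer_lattice"
    "\<And>a. a \<in> R \<Longrightarrow> \<exists>b. \<forall>x\<in>P. a \<bullet> x \<le> b"
    "\<And>x z. x \<in> P \<Longrightarrow> \<forall>a\<in>R. a \<bullet> z \<le> 0 \<Longrightarrow> x + z \<in> P"
    using rational_polyhedron_integral_normals[OF assms(1)] by blast
  have "\<forall>m::nat. \<exists>x. x \<in> P \<and> x \<in> integer_lattice \<and> f x < - real m"
    using unb unfolding unbounded_below_on_def by blast
  then obtain x where x: "\<And>m. x m \<in> P" "\<And>m. x m \<in> integer_lattice" "\<And>m. f (x m) < - real m"
    by metis
  have bdd: "\<forall>a\<in>R. \<exists>b. \<forall>m. a \<bullet> x m \<le> b" using R(3) x(1) by blast
  obtain A and N :: nat and r :: "nat \<Rightarrow> nat" where A: "finite A" "A \<subseteq> integer_lattice" "R \<subseteq> A"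
    and pointed: "\<And>d. d \<noteq> 0 \<Longrightarrow> \<forall>a\<in>A. a \<bullet> d \<le> 0 \<Longrightarrow> \<exists>a\<in>A. a \<bullet> d < 0"
    and r: "strict_mono r" "\<And>m a. m \<ge> N \<Longrightarrow> a \<in> A \<Longrightarrow> a \<bullet> (x (r m) - x (r N)) \<le> 0"
    by (rule descending_in_pointed_cone[of R x, OF R(1,2) x(2) bdd]) (rule that)
  define v where "v = x (r N)"
  define g where "g = 2 *\<^sub>R q v + c"
  have fv: "f (v + z) = z \<bullet> q z + g \<bullet> z + f v" for z
    using quadratic_via_translate[OF lin sa] by (simp add: f g_def quadratic_via_def)
  have "\<exists>d. (\<forall>a\<in>A. a \<bullet> d \<le> 0) \<and> (d \<bullet> q d < 0 \<or> d \<bullet> q d = 0 \<and> g \<bullet> d < 0)"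
  proof (rule ccontr)
    assume "\<not> ?thesis"
    then have "\<exists>M. \<forall>z. (\<forall>a\<in>A. a \<bullet> z \<le> 0) \<longrightarrow> (\<forall>a\<in>{}. a \<bullet> z = 0) \<longrightarrow> M \<le> z \<bullet> q z + g \<bullet> z"
      by (intro copositive_bounded_below_on_face[OF lin sa A(1) pointed]) (auto simp: not_less)
    then obtain M where M: "\<And>z. \<forall>a\<in>A. a \<bullet> z \<le> 0 \<Longrightarrow> M \<le> z \<bullet> q z + g \<bullet> z" by auto
    \<comment> \<open>A lower bound on the cone contradicts the values of \<open>f\<close> along the subsequence, all of whose
      members from index \<open>N\<close> on lie in \<open>v\<close> plus the cone.\<close>
    obtain m where m: "real m > - (M + f v)" using reals_Archimedean2 by blast
    define l where "l = max m N"
    have "M + f v \<le> f (v + (x (r l) - v))"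
      unfolding fv using M[of "x (r l) - v"] r(2)[of l] by (simp add: l_def v_def)
    also have "\<dots> < - real (r l)" using x(3) by simp
    also have "\<dots> \<le> - real m"
      using seq_suble[OF r(1), of l] by (simp add: l_def)
    finally show False using m by simp
  qed
  then obtain d where d: "\<forall>a\<in>A. a \<bullet> d \<le> 0" "d \<bullet> q d < 0 \<or> d \<bullet> q d = 0 \<and> g \<bullet> d < 0" by blast
  show ?ray
  proof (intro exI conjI allI impI)
    show "d \<noteq> 0" using d(2) by auto
    show "ray v d \<subseteq> P"
    proof
      fix y assume "y \<in> ray v d"
      then obtain t where t: "0 \<le> t" "y = v + t *\<^sub>R d" by (auto simp: ray_def)
      have "\<forall>a\<in>R. a \<bullet> (t *\<^sub>R d) \<le> 0" using t(1) d(1) A(3) by (auto simp: mult_nonneg_nonpos)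
      then show "y \<in> P" using R(4) x(1) t(2) by (auto simp: v_def)
    qed
    fix \<epsilon> :: real assume "\<epsilon> > 0"
    show "unbounded_below_on f (P \<inter> integer_lattice \<inter> (ray v d + cball 0 \<epsilon>))"
      unfolding unbounded_below_on_def
    proof
      fix C
      obtain t z where tz: "0 \<le> t" "z \<in> integer_lattice" "norm (z - t *\<^sub>R d) \<le> \<epsilon>"
        "\<forall>a\<in>A. a \<bullet> z \<le> 0" "z \<bullet> q z + g \<bullet> z < C - f v"
        using unbounded_below_near_escaping_ray[OF lin sa A(1,2) d \<open>\<epsilon> > 0\<close>] by metis
      have "v + z \<in> P" unfolding v_def using R(4)[OF x(1)] tz(4) A(3) by blast
      moreover have "v + z \<in> integer_lattice"
        using x(2) tz(2) by (auto simp: v_def integer_lattice_def)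
      moreover have "(v + t *\<^sub>R d) + (z - t *\<^sub>R d) \<in> ray v d + cball 0 \<epsilon>"
        using tz(1,3) by (intro set_plus_intro) (auto simp: ray_def)
      moreover have "f (v + z) < C" using tz(5) by (simp add: fv)
      ultimately show "\<exists>y\<in>P \<inter> integer_lattice \<inter> (ray v d + cball 0 \<epsilon>). f y < C"
        by (intro bexI[of _ "v + z"]) auto
    qed
  qed
qed

end
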